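(* There is an absolute constant $K>0$ such that for all integers $m,n\ge 2$ the following holds. In the random access model, there is a Preference Elicitation algorithm for the class of all single crossing profiles of $n$ voters over $m$ candidates (so the algorithm is not given any ordering of the voters with respect to which the profile is single crossing), whose query complexity is at most $K\,(mn+m^3\log m)$; that is, the query complexity is $O(mn+m^3\log m)$.
   Context: Let $\mathcal{C}$ be a set of $m$ candidates and $[n]=\{1,\dots,n\}$ the set of voters. A preference is a strict total order on $\mathcal{C}$; a profile is an $n$-tuple $\mathcal{P}=(\succ_1,\dots,\succ_n)$ of preferences. A profile $\mathcal{P}$ is single crossing if there exists a permutation $\sigma$ of $[n]$ such that for every two distinct $x,y\in\mathcal{C}$, whenever $x\succ_{\sigma(i)}y$ and $x\succ_{\sigma(j)}y$ with $1\le i<j\le n$, then $x\succ_{\sigma(k)}y$ for every $i\le k\le j$. The oracle $\mathrm{Query}(x\succ_\ell y)$ ($\ell$ a voter, $x\ne y$ candidates) returns true if voter $\ell$ prefers $x$ to $y$, and false otherwise. A Preference Elicitation algorithm for a class of profiles is a deterministic adaptive procedure that, for every unknown profile $\mathcal{P}$ in the class, outputs $\mathcal{P}$ exactly using only oracle calls. Its query complexity is the maximum, over profiles in the class, of the number of pairs (voter $\ell$, unordered pair $\{x,y\}$ of distinct candidates) for which the algorithm compares $x$ and $y$ for voter $\ell$ (repeated calls are counted once). In the random access model any voter may be queried at any time, and queries to different voters may be interleaved. Logarithms are base 2. *)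

theory Defs
  imports Complex_Main "HOL-Library.FuncSet" "HOL-Combinatorics.Permutations"
begin

text \<open>A preference is a set of pairs; \<open>(x, y) \<in> r\<close> means that \<open>x\<close> is strictly preferred to \<open>y\<close>.\<close>

definition preferences :: "'c set \<Rightarrow> 'c rel set" where
  "preferences C = {r. r \<subseteq> C \<times> C \<and> strict_linear_order_on C r}"

text \<open>Voters are \<open>1, \<dots>, n\<close>. Extensionality makes equality of two profiles the same as
  equality of the two \<open>n\<close>-tuples of preferences.\<close>

type_synonym 'c profile = "nat \<Rightarrow> 'c rel"

definition profiles :: "'c set \<Rightarrow> nat \<Rightarrow> 'c profile set" where
  "profiles C n = {1..n} \<rightarrow>\<^sub>E preferences C"

definition single_crossing :: "'c set \<Rightarrow> nat \<Rightarrow> 'c profile \<Rightarrow> bool" where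
  "single_crossing C n P \<longleftrightarrow>
     (\<exists>\<sigma>. \<sigma> permutes {1..n} \<and>
       (\<forall>x\<in>C. \<forall>y\<in>C. x \<noteq> y \<longrightarrow>
         (\<forall>i j. 1 \<le> i \<and> i < j \<and> j \<le> n \<and> (x, y) \<in> P (\<sigma> i) \<and> (x, y) \<in> P (\<sigma> j) \<longrightarrow>
           (\<forall>k. i \<le> k \<and> k \<le> j \<longrightarrow> (x, y) \<in> P (\<sigma> k)))))"

definition single_crossing_profiles :: "'c set \<Rightarrow> nat \<Rightarrow> 'c profile set" where
  "single_crossing_profiles C n = {P \<in> profiles C n. single_crossing C n P}"

text \<open>A deterministic adaptive procedure is a decision tree. The node \<open>Query l x y A B\<close> calls the
  oracle on \<open>x \<succ>\<^sub>l y\<close> and continues with \<open>A\<close> if the answer is true and with \<open>B\<close> otherwise.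
  The voter \<open>l\<close> is unrestricted at every node, which is the random access model.\<close>

datatype 'c algorithm =
  Output "'c profile"
| Query nat 'c 'c "'c algorithm" "'c algorithm"

primrec valid_queries :: "'c set \<Rightarrow> nat \<Rightarrow> 'c algorithm \<Rightarrow> bool" where
  "valid_queries C n (Output Q) \<longleftrightarrow> True"
| "valid_queries C n (Query l x y A B) \<longleftrightarrow>
     l \<in> {1..n} \<and> x \<in> C \<and> y \<in> C \<and> x \<noteq> y \<and> valid_queries C n A \<and> valid_queries C n B"

primrec run :: "'c algorithm \<Rightarrow> 'c profile \<Rightarrow> 'c profile" where
  "run (Output Q) P = Q"
| "run (Query l x y A B) P = (if (x, y) \<in> P l then run A P else run B P)"

text \<open>Collecting the comparisons in a set of pairs (voter, unordered pair of candidates) counts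
  repeated calls once.\<close>

primrec comparisons :: "'c algorithm \<Rightarrow> 'c profile \<Rightarrow> (nat \<times> 'c set) set" where
  "comparisons (Output Q) P = {}"
| "comparisons (Query l x y A B) P =
     insert (l, {x, y}) (if (x, y) \<in> P l then comparisons A P else comparisons B P)"

definition preference_elicitation ::
    "'c set \<Rightarrow> nat \<Rightarrow> 'c profile set \<Rightarrow> 'c algorithm \<Rightarrow> bool" where
  "preference_elicitation C n \<P> A \<longleftrightarrow> valid_queries C n A \<and> (\<forall>P\<in>\<P>. run A P = P)"

definition query_complexity :: "'c profile set \<Rightarrow> 'c algorithm \<Rightarrow> nat" where
  "query_complexity \<P> A = Max ((\<lambda>P. card (comparisons A P)) ` \<P>)"

text \<open>The maximum above is over a finite nonempty set in the case of interest.\<close>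

lemma finite_single_crossing_profiles:
  assumes "finite C"
  shows "finite (single_crossing_profiles C n)"
proof -
  have "preferences C \<subseteq> Pow (C \<times> C)"
    by (auto simp: preferences_def)
  then have "finite (preferences C)"
    using assms by (meson finite_Pow_iff finite_SigmaI finite_subset)
  then have "finite (profiles C n)"
    unfolding profiles_def by (intro finite_PiE) auto
  then show ?thesis
    unfolding single_crossing_profiles_def by simp
qed

lemma single_crossing_profiles_nonempty:
  fixes C :: "'c::linorder set"
  shows "single_crossing_profiles C n \<noteq> {}"
proof -
  define r where "r = {(x, y). x \<in> C \<and> y \<in> C \<and> x < y}"
  define P where "P = (\<lambda>i\<in>{1..n}. r)"
  have "r \<in> preferences C"
    unfolding preferences_def strict_linear_order_on_def r_def
    by (auto simp: trans_def irrefl_def total_on_def)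
  then have "P \<in> profiles C n"
    unfolding profiles_def P_def by auto
  moreover have "single_crossing C n P"
    unfolding single_crossing_def
    by (rule exI[of _ id]) (auto simp: P_def permutes_id)
  ultimately show ?thesis
    unfolding single_crossing_profiles_def by blast
qed

end

theory Submission
  imports Defs
begin

text \<open>A single crossing profile contains at most \<open>m\<^sup>2 + 1\<close> distinct preferences: in the single
  crossing order each new preference reverses a pair that was never reversed before. Process the
  voters one after the other, keeping the set \<open>D\<close> of preferences met so far. Since \<open>D\<close> is itself
  single crossing, any two neighbours in its order are separated by a pair of candidates that
  separates all earlier from all later members. Binary search with \<open>O(m)\<close> queries therefore
  leaves a single member \<open>r\<close> of \<open>D\<close> that the current voter can have, and comparing the neighbours
  of \<open>r\<close> takes \<open>O(m)\<close> queries to decide whether the voter has it. Only if not, the preference is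
  sorted by binary insertion with \<open>O(m log m)\<close> queries; this happens at most \<open>m\<^sup>2 + 1\<close> times.\<close>

section \<open>Enumerating strict linear orders\<close>

text \<open>Injectivity of \<open>f\<close> makes sorting by \<open>f\<close> strict. The rank will
  be the number of better candidates when a preference is listed, and a position in the single
  crossing order when a set of preferences is listed.\<close>

lemma finite_enumeration_by_rank:
  fixes f :: "'a \<Rightarrow> nat"
  assumes "finite A" "inj_on f A"
  obtains xs where "set xs = A" "length xs = card A" "distinct xs"
    "\<And>i j. i < length xs \<Longrightarrow> j < length xs \<Longrightarrow> f (xs ! i) < f (xs ! j) \<longleftrightarrow> i < j"
proof -
  obtain ys where ys: "set ys = A" "distinct ys"
    using finite_distinct_list[OF assms(1)] by blast
  define xs where "xs = sort_key f ys"
  have xs: "set xs = A" "distinct xs" "sorted (map f xs)"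
    using ys by (auto simp: xs_def)
  have less: "f (xs ! i) < f (xs ! j)" if "i < j" "j < length xs" for i j
  proof -
    have "f (xs ! i) \<le> f (xs ! j)"
      using xs(3) that by (simp add: sorted_iff_nth_mono)
    moreover have "xs ! i \<noteq> xs ! j"
      using xs(2) that by (simp add: nth_eq_iff_index_eq)
    then have "f (xs ! i) \<noteq> f (xs ! j)"
      using assms(2) xs(1) that by (metis inj_onD nth_mem order.strict_trans)
    ultimately show ?thesis by simp
  qed
  have iff: "f (xs ! i) < f (xs ! j) \<longleftrightarrow> i < j" if "i < length xs" "j < length xs" for i j
    using less[of i j] less[of j i] that by (metis less_asym less_irrefl linorder_less_linear)
  have "length xs = card A"
    using xs(1,2) distinct_card by fastforce
  with xs iff that show thesis by blast
qed

lemma preferencesD: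
  assumes "r \<in> preferences C"
  shows "r \<subseteq> C \<times> C" "trans r" "irrefl r" "total_on C r" "(x, y) \<in> r \<Longrightarrow> (y, x) \<notin> r"
  using assms unfolding preferences_def strict_linear_order_on_def
  by (auto dest: transD irreflD)

lemma preferences_total:
  "r \<in> preferences C \<Longrightarrow> x \<in> C \<Longrightarrow> y \<in> C \<Longrightarrow> x \<noteq> y \<Longrightarrow> (x, y) \<notin> r \<Longrightarrow> (y, x) \<in> r"
  using preferencesD(4) unfolding total_on_def by blast

lemma preferences_restrict:
  assumes "r \<in> preferences C" "B \<subseteq> C"
  shows "r \<inter> B \<times> B \<in> preferences B"
  unfolding preferences_def strict_linear_order_on_def mem_Collect_eq
proof (intro conjI)
  show "trans (r \<inter> B \<times> B)"
    using preferencesD(2)[OF assms(1)] by (auto intro!: transI dest: transD)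
  show "irrefl (r \<inter> B \<times> B)"
    using preferencesD(3)[OF assms(1)] by (simp add: irrefl_def)
  show "total_on B (r \<inter> B \<times> B)"
    using preferencesD(4)[OF assms(1)] assms(2) by (auto simp: total_on_def)
qed simp

text \<open>Strict linear orders are maximal: by totality, any further pair would reverse a pair
  already present.\<close>

lemma preferences_subset_eq:
  assumes "r \<in> preferences C" "s \<in> preferences C" "r \<subseteq> s"
  shows "r = s"
proof
  show "s \<subseteq> r"
  proof (rule subrelI)
    fix x y assume xy: "(x, y) \<in> s"
    then have "x \<in> C" "y \<in> C" "x \<noteq> y" "(y, x) \<notin> s"
      using preferencesD(1,3,5)[OF assms(2)] by (auto dest: irreflD)
    then show "(x, y) \<in> r"
      using preferences_total[OF assms(1)] assms(3) by blast
  qed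
qed fact

text \<open>Transitivity and irreflexivity make the number of candidates preferred to
  \<open>x\<close> grow strictly along \<open>r\<close>, so this number serves as a rank.\<close>

lemma preferences_enumeration:
  assumes "r \<in> preferences C" "finite C"
  obtains xs where "set xs = C" "length xs = card C"
    "\<And>i j. i < length xs \<Longrightarrow> j < length xs \<Longrightarrow> (xs ! i, xs ! j) \<in> r \<longleftrightarrow> i < j"
proof -
  define f where "f = (\<lambda>x. card {b. (b, x) \<in> r})"
  note r = preferencesD[OF assms(1)]
  have less: "f x < f y" if xy: "(x, y) \<in> r" for x y
    unfolding f_def
  proof (rule psubset_card_mono)
    show "finite {b. (b, y) \<in> r}"
      by (rule finite_subset[OF _ assms(2)]) (use r(1) in auto)
    have "x \<notin> {b. (b, x) \<in> r}" "x \<in> {b. (b, y) \<in> r}"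
      using r(3) xy by (auto dest: irreflD)
    moreover have "{b. (b, x) \<in> r} \<subseteq> {b. (b, y) \<in> r}"
      using r(2) xy by (auto dest: transD)
    ultimately show "{b. (b, x) \<in> r} \<subset> {b. (b, y) \<in> r}" by blast
  qed
  have iff: "f x < f y \<longleftrightarrow> (x, y) \<in> r" if "x \<in> C" "y \<in> C" for x y
    using less[of x y] less[of y x] preferences_total[OF assms(1) that] by fastforce
  have "inj_on f C"
    using less preferences_total[OF assms(1)] by (metis inj_onI less_irrefl)
  with assms(2) obtain xs where xs: "set xs = C" "length xs = card C"
    "\<And>i j. i < length xs \<Longrightarrow> j < length xs \<Longrightarrow> f (xs ! i) < f (xs ! j) \<longleftrightarrow> i < j"
    by (metis finite_enumeration_by_rank)
  have "(xs ! i, xs ! j) \<in> r \<longleftrightarrow> i < j" if "i < length xs" "j < length xs" for i j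
    using iff[of "xs ! i" "xs ! j"] xs that by (metis nth_mem)
  with xs(1,2) that show thesis by blast
qed

section \<open>Subsets of single crossing profiles\<close>

text \<open>Sort \<open>D\<close> by position in the single crossing order. Neighbours in this list
  are distinct, so some pair is reversed between them; being reversed there, it cannot be reversed
  anywhere else, hence it separates the whole list.\<close>

lemma single_crossing_enumeration:
  assumes "P \<in> profiles C n" "single_crossing C n P" "D \<subseteq> P ` {1..n}"
  obtains rs where "set rs = D" "length rs = card D" "distinct rs"
    "\<And>i. 0 < i \<Longrightarrow> i < length rs \<Longrightarrow>
       \<exists>x\<in>C. \<exists>y\<in>C. x \<noteq> y \<and> (\<forall>j<length rs. (x, y) \<in> rs ! j \<longleftrightarrow> j < i)"
proof -
  obtain \<sigma> where \<sigma>: "\<sigma> permutes {1..n}" and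
    all: "\<forall>x\<in>C. \<forall>y\<in>C. x \<noteq> y \<longrightarrow>
      (\<forall>i j. 1 \<le> i \<and> i < j \<and> j \<le> n \<and> (x, y) \<in> P (\<sigma> i) \<and> (x, y) \<in> P (\<sigma> j) \<longrightarrow>
        (\<forall>k. i \<le> k \<and> k \<le> j \<longrightarrow> (x, y) \<in> P (\<sigma> k)))"
    using assms(2) unfolding single_crossing_def by (elim exE conjE)
  have sc: "(x, y) \<in> P (\<sigma> k)"
    if "x \<in> C" "y \<in> C" "x \<noteq> y" "1 \<le> i" "i < j" "j \<le> n"
      "(x, y) \<in> P (\<sigma> i)" "(x, y) \<in> P (\<sigma> j)" "i \<le> k" "k \<le> j" for x y i j k
    using all[rule_format, of x y i j k] that by simp
  have "\<exists>i. i \<in> {1..n} \<and> P (\<sigma> i) = r" if r: "r \<in> D" for r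
  proof -
    obtain k where "k \<in> {1..n}" "P k = r" using r assms(3) by blast
    then show ?thesis using permutes_image[OF \<sigma>] by (metis imageE)
  qed
  \<comment> \<open>Several voters may share the preference \<open>r\<close>; \<open>f r\<close>
    fixes one of their positions.\<close>
  then obtain f where f: "\<And>r. r \<in> D \<Longrightarrow> f r \<in> {1..n} \<and> P (\<sigma> (f r)) = r" by metis
  have "inj_on f D" by (metis f inj_onI)
  moreover have "finite D" using assms(3) finite_surj by blast
  ultimately obtain rs where rs: "set rs = D" "length rs = card D" "distinct rs"
    "\<And>i j. i < length rs \<Longrightarrow> j < length rs \<Longrightarrow> f (rs ! i) < f (rs ! j) \<longleftrightarrow> i < j"
    using finite_enumeration_by_rank by metis
  have pref: "rs ! i \<in> preferences C" if "i < length rs" for i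
  proof -
    have "rs ! i \<in> P ` {1..n}" using that rs(1) assms(3) nth_mem by blast
    then show ?thesis using assms(1) unfolding profiles_def by auto
  qed
  have between: "(x, y) \<in> rs ! j"
    if "(x, y) \<in> rs ! i" "(x, y) \<in> rs ! k" "i < j" "j < k" "k < length rs" for x y i j k
  proof -
    have "x \<in> C" "y \<in> C" "x \<noteq> y"
      using that preferencesD(1,3)[OF pref[OF that(5)]] by (auto dest: irreflD)
    moreover have "rs ! i \<in> D" "rs ! j \<in> D" "rs ! k \<in> D"
      using rs(1) that by auto
    moreover have "f (rs ! i) < f (rs ! j)" "f (rs ! j) < f (rs ! k)"
      using rs(4) that by auto
    ultimately show ?thesis
      using sc[of x y "f (rs ! i)" "f (rs ! k)" "f (rs ! j)"] f that(1,2) by fastforce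
  qed
  have sep: "\<exists>x\<in>C. \<exists>y\<in>C. x \<noteq> y \<and> (\<forall>j<length rs. (x, y) \<in> rs ! j \<longleftrightarrow> j < i)"
    if i: "0 < i" "i < length rs" for i
  proof -
    have p: "rs ! (i - 1) \<in> preferences C" "rs ! i \<in> preferences C"
      using pref i by auto
    have "rs ! (i - 1) \<noteq> rs ! i"
      using rs(3) i by (simp add: nth_eq_iff_index_eq)
    then have "\<not> rs ! (i - 1) \<subseteq> rs ! i" using preferences_subset_eq[OF p] by blast
    then obtain x y where xy: "(x, y) \<in> rs ! (i - 1)" "(x, y) \<notin> rs ! i"
      by (meson subrelI)
    then have C: "x \<in> C" "y \<in> C" "x \<noteq> y"
      using preferencesD(1,3)[OF p(1)] by (auto dest: irreflD)
    \<comment> \<open>Both orientations are needed: \<open>between\<close> for \<open>(y, x)\<close>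
      controls the members before \<open>i\<close>, and for \<open>(x, y)\<close> those after
      \<open>i\<close>.\<close>
    have yx: "(y, x) \<in> rs ! i" "(y, x) \<notin> rs ! (i - 1)"
      using preferences_total[OF p(2)] preferencesD(5)[OF p(1)] C xy by auto
    have "(x, y) \<in> rs ! j \<longleftrightarrow> j < i" if j: "j < length rs" for j
    proof (cases "j < i")
      case True
      have "(x, y) \<in> rs ! j"
      proof (rule ccontr)
        assume n: "(x, y) \<notin> rs ! j"
        then have "(y, x) \<in> rs ! j" using preferences_total[OF pref[OF j]] C by blast
        moreover have "j < i - 1" using True n xy(1) by (cases "j = i - 1") auto
        ultimately show False
          using between[of y x j i "i - 1"] yx i by auto
      qed
      with True show ?thesis by simp
    next
      case False
      have "(x, y) \<notin> rs ! j"
      proof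
        assume j': "(x, y) \<in> rs ! j"
        then have "i < j" using False xy(2) by (cases "i = j") auto
        then show False
          using between[OF xy(1) j', of i] xy(2) i j by auto
      qed
      with False show ?thesis by simp
    qed
    with C show ?thesis by blast
  qed
  show thesis using that[OF rs(1,2,3) sep] by blast
qed

text \<open>The pairs separating at different places of the list differ, because each one determines
  the length of the initial segment on which it holds. So the list has at most
  \<open>card C ^ 2\<close> inner cuts.\<close>

lemma single_crossing_card_image:
  assumes "P \<in> profiles C n" "single_crossing C n P" "finite C"
  shows "card (P ` {1..n}) \<le> card C ^ 2 + 1"
proof -
  obtain rs where rs: "length rs = card (P ` {1..n})"
    "\<And>i. 0 < i \<Longrightarrow> i < length rs \<Longrightarrow>
       \<exists>x\<in>C. \<exists>y\<in>C. x \<noteq> y \<and> (\<forall>j<length rs. (x, y) \<in> rs ! j \<longleftrightarrow> j < i)"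
    using single_crossing_enumeration[OF assms(1,2) order.refl] by metis
  have "\<exists>p \<in> C \<times> C. \<forall>j<length rs. p \<in> rs ! j \<longleftrightarrow> j < i" if "i \<in> {0<..<length rs}" for i
    using rs(2)[of i] that by auto
  then obtain p where p: "\<And>i. i \<in> {0<..<length rs} \<Longrightarrow> p i \<in> C \<times> C"
    "\<And>i j. i \<in> {0<..<length rs} \<Longrightarrow> j < length rs \<Longrightarrow> p i \<in> rs ! j \<longleftrightarrow> j < i"
    by metis
  have "inj_on p {0<..<length rs}"
  proof (rule inj_onI)
    fix i j assume *: "i \<in> {0<..<length rs}" "j \<in> {0<..<length rs}" "p i = p j"
    then have "k < i \<longleftrightarrow> k < j" if "k < length rs" for k
      using p(2) that by metis
    with * show "i = j" by (metis greaterThanLessThan_iff less_irrefl linorder_less_linear)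
  qed
  then have "card {0<..<length rs} \<le> card (C \<times> C)"
    using p(1) assms(3) by (intro card_inj_on_le image_subsetI) auto
  then show ?thesis
    using rs(1) by (simp add: card_cartesian_product power2_eq_square)
qed

section \<open>Elicitation from a state of knowledge\<close>

text \<open>The set \<open>S\<close> consists of the profiles that are consistent with the answers received so far.
  Algorithms are assembled by rules for this predicate, whose bound \<open>k\<close> holds in the worst case
  over \<open>S\<close>.\<close>

definition elicitable :: "'c set \<Rightarrow> nat \<Rightarrow> 'c profile set \<Rightarrow> nat \<Rightarrow> bool" where
  "elicitable C n S k \<longleftrightarrow> (\<exists>A. valid_queries C n A \<and>
     (\<forall>P\<in>S. run A P = P \<and> card (comparisons A P) \<le> k))"

lemma elicitable_mono:
  "elicitable C n T j \<Longrightarrow> S \<subseteq> T \<Longrightarrow> j \<le> k \<Longrightarrow> elicitable C n S k"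
  unfolding elicitable_def by (meson order.trans subsetD)

text \<open>Covers a fully determined state and also an empty one, that is, answers that no profile
  produces.\<close>

lemma elicitable_subset_singleton: "S \<subseteq> {P} \<Longrightarrow> elicitable C n S k"
  unfolding elicitable_def by (rule exI[of _ "Output P"]) auto

lemma elicitable_query:
  fixes C :: "'c set"
  assumes "l \<in> {1..n}" "x \<in> C" "y \<in> C" "x \<noteq> y"
    and "elicitable C n {P \<in> S. (x, y) \<in> P l} k"
    and "elicitable C n {P \<in> S. (x, y) \<notin> P l} k"
  shows "elicitable C n S (Suc k)"
proof -
  obtain A B where AB: "valid_queries C n A" "valid_queries C n B"
    "\<And>P. P \<in> S \<Longrightarrow> (x, y) \<in> P l \<Longrightarrow> run A P = P \<and> card (comparisons A P) \<le> k"
    "\<And>P. P \<in> S \<Longrightarrow> (x, y) \<notin> P l \<Longrightarrow> run B P = P \<and> card (comparisons B P) \<le> k"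
    using assms(5,6) unfolding elicitable_def by blast
  \<comment> \<open>An infinite set has cardinality 0 and stays infinite under insertion, so the
    estimate holds without a finiteness proof.\<close>
  have card: "card (insert a X) \<le> Suc k" if "card X \<le> k" for a and X :: "(nat \<times> 'c set) set"
    using that by (cases "finite X") (auto simp: card_insert_if)
  show ?thesis
    unfolding elicitable_def
    by (rule exI[of _ "Query l x y A B"]) (use assms(1-4) AB card in auto)
qed

text \<open>The profiles with \<open>f P \<ge> N\<close> are those outside the searched list. Nothing is known about
  their answers, so each of them survives in the final state of some outcome.\<close>

lemma elicitable_binary_search:
  fixes f :: "'c profile \<Rightarrow> nat"
  assumes l: "l \<in> {1..n}"
    and sep: "\<And>i. 0 < i \<Longrightarrow> i < N \<Longrightarrow>
      \<exists>x\<in>C. \<exists>y\<in>C. x \<noteq> y \<and> (\<forall>P\<in>S. f P < N \<longrightarrow> ((x, y) \<in> P l \<longleftrightarrow> f P < i))"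
    and fin: "\<And>i. i < N \<Longrightarrow> elicitable C n {P \<in> S. f P = i \<or> f P \<ge> N} k"
    and N: "0 < N" "N \<le> 2 ^ d"
  shows "elicitable C n S (k + d)"
proof -
  \<comment> \<open>Invariant of the search: a listed profile has its index in the window from
    \<open>a\<close> to \<open>b\<close>, exclusive of \<open>b\<close>, which has length at most
    \<open>2 ^ d\<close>.\<close>
  have "elicitable C n (U \<inter> {P. a \<le> f P \<and> f P < b \<or> f P \<ge> N}) (k + d)"
    if "a < b" "b \<le> N" "b \<le> a + 2 ^ d" "U \<subseteq> S" for a b d U
    using that
  proof (induction d arbitrary: a b U)
    case 0
    then have "b = Suc a" by simp
    then show ?case
      using 0 by (intro elicitable_mono[OF fin[of a]]) auto
  next
    case (Suc d)
    show ?case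
    proof (cases "b \<le> a + 2 ^ d")
      case True
      then show ?thesis
        using Suc.prems by (intro elicitable_mono[OF Suc.IH[of a b U]]) auto
    next
      case False
      \<comment> \<open>Cutting here instead of in the middle keeps both parts nonempty and of
        length at most \<open>2 ^ d\<close>. Windows already that short were handled without a
        query.\<close>
      define c where "c = a + 2 ^ d"
      have c: "a < c" "c < b" "c \<le> N" "c \<le> a + 2 ^ d" "b \<le> c + 2 ^ d"
        using False Suc.prems by (auto simp: c_def)
      obtain x y where xy: "x \<in> C" "y \<in> C" "x \<noteq> y"
        and *: "\<And>P. P \<in> S \<Longrightarrow> f P < N \<Longrightarrow> (x, y) \<in> P l \<longleftrightarrow> f P < c"
        using sep[of c] c Suc.prems by auto
      have "elicitable C n (U \<inter> {P. a \<le> f P \<and> f P < c \<or> f P \<ge> N}) (k + d)"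
        "elicitable C n (U \<inter> {P. c \<le> f P \<and> f P < b \<or> f P \<ge> N}) (k + d)"
        using Suc.IH c Suc.prems by auto
      then have "elicitable C n (U \<inter> {P. a \<le> f P \<and> f P < b \<or> f P \<ge> N}) (Suc (k + d))"
        by (intro elicitable_query[OF l xy])
          (elim elicitable_mono; use * Suc.prems in force)+
      then show ?thesis by simp
    qed
  qed
  from this[of 0 N d S] N show ?thesis
    by (auto elim!: elicitable_mono)
qed

text \<open>The pairs of \<open>V\<close> are queried one by one, and the first negative answer ends
  the test.\<close>

lemma elicitable_verify_pairs:
  assumes l: "l \<in> {1..n}" and "finite V" "\<And>x y. (x, y) \<in> V \<Longrightarrow> x \<in> C \<and> y \<in> C \<and> x \<noteq> y"
    and "elicitable C n {P \<in> S. V \<subseteq> P l} k" "elicitable C n {P \<in> S. \<not> V \<subseteq> P l} k"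
  shows "elicitable C n S (k + card V)"
  using assms(2-)
proof (induction V arbitrary: S rule: finite_induct)
  case empty
  then show ?case by simp
next
  case (insert v V)
  obtain x y where v: "v = (x, y)" by fastforce
  have yes: "elicitable C n {P \<in> S. (x, y) \<in> P l} (k + card V)"
  proof (rule insert.IH)
    show "elicitable C n {P \<in> {P \<in> S. (x, y) \<in> P l}. V \<subseteq> P l} k"
      by (rule elicitable_mono[OF insert.prems(2)]) (auto simp: v)
    show "elicitable C n {P \<in> {P \<in> S. (x, y) \<in> P l}. \<not> V \<subseteq> P l} k"
      by (rule elicitable_mono[OF insert.prems(3)]) (auto simp: v)
  qed (use insert.prems(1) in auto)
  have no: "elicitable C n {P \<in> S. (x, y) \<notin> P l} (k + card V)"
    by (rule elicitable_mono[OF insert.prems(3)]) (auto simp: v)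
  have "elicitable C n S (Suc (k + card V))"
    using insert.prems(1)[of x y] v by (intro elicitable_query[OF l _ _ _ yes no]) auto
  then show ?case using insert.hyps by simp
qed

text \<open>By transitivity, a strict linear order is determined by its pairs of consecutive
  candidates, of which there are fewer than \<open>card C\<close> when \<open>C\<close> is
  nonempty.\<close>

lemma elicitable_verify:
  assumes l: "l \<in> {1..n}" and C: "finite C" and r: "r \<in> preferences C"
    and S: "\<And>P. P \<in> S \<Longrightarrow> P l \<in> preferences C"
    and eq: "elicitable C n {P \<in> S. P l = r} k" and neq: "elicitable C n {P \<in> S. P l \<noteq> r} k"
  shows "elicitable C n S (k + card C)"
proof -
  obtain xs where xs: "set xs = C" "length xs = card C"
    "\<And>i j. i < length xs \<Longrightarrow> j < length xs \<Longrightarrow> (xs ! i, xs ! j) \<in> r \<longleftrightarrow> i < j"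
    using preferences_enumeration[OF r C] by blast
  define V where "V = (\<lambda>i. (xs ! i, xs ! Suc i)) ` {..<length xs - 1}"
  have V: "V \<subseteq> r" using xs(3) by (auto simp: V_def)
  have determined: "s = r" if s: "s \<in> preferences C" "V \<subseteq> s" for s
  proof -
    have step: "(xs ! i, xs ! j) \<in> s" if "i < j" "j < length xs" for i j
      using that
    proof (induction j)
      case 0
      then show ?case by simp
    next
      case (Suc j)
      have e: "(xs ! j, xs ! Suc j) \<in> s"
        using s(2) Suc.prems by (auto simp: V_def)
      show ?case
      proof (cases "i = j")
        case False
        then have "(xs ! i, xs ! j) \<in> s" using Suc by simp
        then show ?thesis using e preferencesD(2)[OF s(1)] by (auto dest: transD)
      qed (use e in simp)
    qed
    have "r \<subseteq> s"
    proof (rule subrelI)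
      fix x y assume xy: "(x, y) \<in> r"
      then have "x \<in> set xs" "y \<in> set xs" using preferencesD(1)[OF r] xs(1) by auto
      then obtain i j where "i < length xs" "x = xs ! i" "j < length xs" "y = xs ! j"
        by (metis in_set_conv_nth)
      with xy xs(3) step show "(x, y) \<in> s" by blast
    qed
    then show ?thesis using preferences_subset_eq r s(1) by blast
  qed
  have iff: "V \<subseteq> P l \<longleftrightarrow> P l = r" if "P \<in> S" for P
    using determined[OF S[OF that]] V by blast
  have sets: "{P \<in> S. V \<subseteq> P l} = {P \<in> S. P l = r}" "{P \<in> S. \<not> V \<subseteq> P l} = {P \<in> S. P l \<noteq> r}"
    using iff by auto
  have "elicitable C n S (k + card V)"
  proof (rule elicitable_verify_pairs[OF l])
    show "finite V" by (simp add: V_def)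
    show "x \<in> C \<and> y \<in> C \<and> x \<noteq> y" if "(x, y) \<in> V" for x y
      using that V preferencesD(1,3)[OF r] by (auto dest: irreflD)
  qed (use sets eq neq in simp_all)
  moreover have "card V \<le> card C"
    unfolding V_def using card_image_le[of "{..<length xs - 1}"] xs(2)
    by (metis card_lessThan diff_le_self finite_lessThan order.trans)
  ultimately show ?thesis by (auto elim: elicitable_mono)
qed

text \<open>Binary search over the list of \<open>D\<close> costs at most \<open>d\<close> queries
  and leaves one member to verify with \<open>card C\<close> queries. The profile \<open>Q\<close>
  only witnesses that \<open>D\<close> is single crossing; it need not be the unknown one.\<close>

lemma elicitable_lookup:
  assumes l: "l \<in> {1..n}" and C: "finite C"
    and Q: "Q \<in> profiles C n" "single_crossing C n Q" and D: "D \<subseteq> Q ` {1..n}" "card D \<le> 2 ^ d"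
    and S: "\<And>P. P \<in> S \<Longrightarrow> P l \<in> preferences C"
    and old: "\<And>r. r \<in> D \<Longrightarrow> elicitable C n {P \<in> S. P l = r} k"
    and new: "elicitable C n {P \<in> S. P l \<notin> D} k"
  shows "elicitable C n S (k + card C + d)"
proof (cases "D = {}")
  case True
  then show ?thesis using new by (auto elim: elicitable_mono)
next
  case False
  obtain rs where rs: "set rs = D" "length rs = card D" "distinct rs"
    and sep: "\<And>i. 0 < i \<Longrightarrow> i < length rs \<Longrightarrow>
       \<exists>x\<in>C. \<exists>y\<in>C. x \<noteq> y \<and> (\<forall>j<length rs. (x, y) \<in> rs ! j \<longleftrightarrow> j < i)"
    using single_crossing_enumeration[OF Q D(1)] by metis
  \<comment> \<open>The default \<open>length rs\<close> puts voters with a new preference outside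
    the searched list.\<close>
  define f where "f = (\<lambda>P. if P l \<in> D then (THE i. i < length rs \<and> rs ! i = P l) else length rs)"
  have f_in: "f P < length rs \<and> rs ! f P = P l" if "P l \<in> D" for P :: "'a profile"
  proof -
    have "\<exists>!i. i < length rs \<and> rs ! i = P l"
      using that rs(1,3) by (metis distinct_Ex1)
    from theI'[OF this] show ?thesis using that by (simp add: f_def)
  qed
  have f_out: "f P = length rs" if "P l \<notin> D" for P :: "'a profile"
    using that by (simp add: f_def)
  show ?thesis
  proof (rule elicitable_binary_search[OF l, where f = f and N = "length rs"])
    show "\<exists>x\<in>C. \<exists>y\<in>C. x \<noteq> y \<and> (\<forall>P\<in>S. f P < length rs \<longrightarrow> ((x, y) \<in> P l \<longleftrightarrow> f P < i))"
      if "0 < i" "i < length rs" for i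
      using sep[OF that] f_in f_out by (metis less_irrefl)
    show "elicitable C n {P \<in> S. f P = i \<or> f P \<ge> length rs} (k + card C)" if i: "i < length rs" for i
    proof (rule elicitable_verify[OF l C])
      have r: "rs ! i \<in> D" using i rs(1) by auto
      then have "rs ! i \<in> Q ` {1..n}" using D(1) by blast
      then show "rs ! i \<in> preferences C"
        using Q(1) by (auto simp: profiles_def)
      show "elicitable C n {P \<in> {P \<in> S. f P = i \<or> f P \<ge> length rs}. P l = rs ! i} k"
        by (rule elicitable_mono[OF old[OF r]]) auto
      \<comment> \<open>Failing the test against the only surviving member rules out all of
        \<open>D\<close>.\<close>
      have "P l \<notin> D" if "f P = i \<or> f P \<ge> length rs" "P l \<noteq> rs ! i" for P
        using f_in[of P] that by (metis leD)
      then show "elicitable C n {P \<in> {P \<in> S. f P = i \<or> f P \<ge> length rs}. P l \<noteq> rs ! i} k"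
        by (intro elicitable_mono[OF new]) auto
    qed (use S in auto)
    show "0 < length rs" using False rs(1) by auto
    show "length rs \<le> 2 ^ d" using D(2) rs(2) by simp
  qed
qed

text \<open>With \<open>B\<close> already sorted, the place of \<open>x\<close> is one of
  \<open>card B + 1\<close> and can be found by binary search; it fixes the order on
  \<open>insert x B\<close>.\<close>

lemma elicitable_insertion:
  assumes l: "l \<in> {1..n}" and C: "finite C" "insert x B \<subseteq> C" "x \<notin> B" "card B < 2 ^ d"
    and S: "\<And>P. P \<in> S \<Longrightarrow> P l \<in> preferences C"
    and S': "\<And>P. P \<in> S \<Longrightarrow> P l \<inter> B \<times> B = r"
    and fin: "\<And>Q. Q \<in> S \<Longrightarrow>
      elicitable C n {P \<in> S. P l \<inter> insert x B \<times> insert x B = Q l \<inter> insert x B \<times> insert x B} k"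
  shows "elicitable C n S (k + d)"
proof (cases "S = {}")
  case True
  then show ?thesis by (intro elicitable_subset_singleton) auto
next
  case False
  then have "r \<in> preferences B"
    using S S' preferences_restrict C(2) by (metis ex_in_conv insert_subset)
  moreover have "finite B" using C finite_subset by auto
  ultimately obtain xs where xs: "set xs = B" "length xs = card B"
    "\<And>i j. i < length xs \<Longrightarrow> j < length xs \<Longrightarrow> (xs ! i, xs ! j) \<in> r \<longleftrightarrow> i < j"
    using preferences_enumeration by blast
  \<comment> \<open>The insertion place of \<open>x\<close>: the index of the first member of
    \<open>B\<close> below it, or \<open>length xs\<close> if \<open>x\<close> is last.\<close>
  define f where "f = (\<lambda>P. LEAST i. i = length xs \<or> (x, xs ! i) \<in> P l)"
  have f: "f P = length xs \<or> (x, xs ! f P) \<in> P l" "f P \<le> length xs" for P :: "'a profile"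
    unfolding f_def by (rule LeastI[of _ "length xs"], simp) (rule Least_le, simp)
  have f_iff: "(x, xs ! i) \<in> P l \<longleftrightarrow> f P < Suc i" if P: "P \<in> S" and i: "i < length xs" for P i
  proof
    assume "(x, xs ! i) \<in> P l"
    then show "f P < Suc i" unfolding f_def by (simp add: Least_le less_Suc_eq_le)
  next
    assume lt: "f P < Suc i"
    then have x: "(x, xs ! f P) \<in> P l" using f(1)[of P] i by auto
    show "(x, xs ! i) \<in> P l"
    proof (cases "f P = i")
      case False
      then have "(xs ! f P, xs ! i) \<in> r" using xs(3) lt i by auto
      then have "(xs ! f P, xs ! i) \<in> P l" using S'[OF P] by blast
      with x show ?thesis using preferencesD(2)[OF S[OF P]] by (auto dest: transD)
    qed (use x in simp)
  qed
  have determined: "P l \<inter> insert x B \<times> insert x B \<subseteq> Q l \<inter> insert x B \<times> insert x B"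
    if PQ: "P \<in> S" "Q \<in> S" "f P = f Q" for P Q
  proof (rule subrelI)
    have x: "(x, b) \<in> P l \<longleftrightarrow> (x, b) \<in> Q l" if "b \<in> B" for b
      using that xs(1) f_iff PQ by (metis in_set_conv_nth)
    have x': "(b, x) \<in> Q l" if b: "b \<in> B" "(b, x) \<in> P l" for b
    proof -
      have "b \<in> C" "x \<in> C" "b \<noteq> x" using b C by auto
      then show ?thesis
        using b x preferencesD(5)[OF S[OF PQ(1)] b(2)] preferences_total[OF S[OF PQ(2)], of x b]
        by blast
    qed
    fix a b assume ab: "(a, b) \<in> P l \<inter> insert x B \<times> insert x B"
    then have "a \<noteq> b" using preferencesD(3)[OF S[OF PQ(1)]] by (auto dest: irreflD)
    then consider "a = x" "b \<in> B" | "a \<in> B" "b = x" | "a \<in> B" "b \<in> B" using ab by auto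
    then have "(a, b) \<in> Q l"
    proof cases
      case 3
      then have "(a, b) \<in> r" using ab S'[OF PQ(1)] by blast
      then show ?thesis using S'[OF PQ(2)] by blast
    qed (use x x' ab in auto)
    then show "(a, b) \<in> Q l \<inter> insert x B \<times> insert x B" using ab by blast
  qed
  show ?thesis
  \<comment> \<open>All values of \<open>f\<close> are below \<open>Suc (card B)\<close>, so here no
    profile lies outside the searched list.\<close>
  proof (rule elicitable_binary_search[OF l, where f = f and N = "Suc (card B)"])
    show "\<exists>x\<in>C. \<exists>y\<in>C. x \<noteq> y \<and> (\<forall>P\<in>S. f P < Suc (card B) \<longrightarrow> ((x, y) \<in> P l \<longleftrightarrow> f P < i))"
      if "0 < i" "i < Suc (card B)" for i
    proof (rule bexI[of _ x], rule bexI[of _ "xs ! (i - 1)"], intro conjI ballI impI)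
      have i: "i - 1 < length xs" "Suc (i - 1) = i" using that xs(2) by auto
      then have "xs ! (i - 1) \<in> B" using xs(1) nth_mem by blast
      then show "xs ! (i - 1) \<in> C" "x \<noteq> xs ! (i - 1)" "x \<in> C" using C by auto
      show "(x, xs ! (i - 1)) \<in> P l \<longleftrightarrow> f P < i" if "P \<in> S" for P
        using f_iff[OF that i(1)] i(2) by simp
    qed
    show "elicitable C n {P \<in> S. f P = i \<or> f P \<ge> Suc (card B)} k" for i
    proof (cases "\<exists>Q\<in>S. f Q = i")
      case True
      then obtain Q where Q: "Q \<in> S" "f Q = i" by blast
      have "\<not> Suc (card B) \<le> f P" for P using f(2)[of P] xs(2) by simp
      then have "{P \<in> S. f P = i \<or> f P \<ge> Suc (card B)}
          \<subseteq> {P \<in> S. P l \<inter> insert x B \<times> insert x B = Q l \<inter> insert x B \<times> insert x B}"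
        using Q determined by (intro Collect_mono impI conjI subset_antisym) metis+
      then show ?thesis
        by (rule elicitable_mono[OF fin[OF Q(1)]]) simp
    next
      case False
      have "\<not> Suc (card B) \<le> f P" for P using f(2)[of P] xs(2) by simp
      with False have "{P \<in> S. f P = i \<or> f P \<ge> Suc (card B)} = {}" by auto
      then show ?thesis by (intro elicitable_subset_singleton) auto
    qed
  qed (use C(4) in auto)
qed

text \<open>Induction on \<open>B\<close> with \<open>k\<close> arbitrary: the last insertion
  follows the sorting of the rest, so its cost \<open>d\<close> is absorbed into the budget
  \<open>k + d\<close> of the induction hypothesis.\<close>

lemma elicitable_insertion_sort:
  assumes l: "l \<in> {1..n}" and C: "finite C" "B \<subseteq> C" "card C \<le> 2 ^ d"
    and S: "\<And>P. P \<in> S \<Longrightarrow> P l \<in> preferences C"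
    and fin: "\<And>Q. Q \<in> S \<Longrightarrow> elicitable C n {P \<in> S. P l \<inter> B \<times> B = Q l \<inter> B \<times> B} k"
  shows "elicitable C n S (k + card B * d)"
proof -
  have "finite B" using C finite_subset by blast
  then show ?thesis
    using C(2) fin
  proof (induction B arbitrary: k rule: finite_induct)
    case empty
    show ?case
    proof (cases "S = {}")
      case True
      then show ?thesis by (intro elicitable_subset_singleton) auto
    next
      case False
      with empty show ?thesis by auto
    qed
  next
    case (insert x B)
    have "card B < card C"
      using insert.hyps insert.prems(1) C(1) by (intro psubset_card_mono) auto
    then have B: "card B < 2 ^ d" using C(3) by simp
    have "elicitable C n S (k + d + card B * d)"
    proof (rule insert.IH)
      fix Q assume Q: "Q \<in> S"
      show "elicitable C n {P \<in> S. P l \<inter> B \<times> B = Q l \<inter> B \<times> B} (k + d)"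
      proof (rule elicitable_insertion[OF l C(1) insert.prems(1) insert.hyps(2) B])
        fix R assume "R \<in> {P \<in> S. P l \<inter> B \<times> B = Q l \<inter> B \<times> B}"
        then show "elicitable C n {P \<in> {P \<in> S. P l \<inter> B \<times> B = Q l \<inter> B \<times> B}.
            P l \<inter> insert x B \<times> insert x B = R l \<inter> insert x B \<times> insert x B} k"
          by (intro elicitable_mono[OF insert.prems(2)[of R]]) auto
      qed (use S in auto)
    qed (use insert.prems in auto)
    then show ?case using insert.hyps by (simp add: algebra_simps)
  qed
qed

lemma elicitable_sort:
  assumes l: "l \<in> {1..n}" and C: "finite C" "card C \<le> 2 ^ d"
    and S: "\<And>P. P \<in> S \<Longrightarrow> P l \<in> preferences C"
    and fin: "\<And>Q. Q \<in> S \<Longrightarrow> elicitable C n {P \<in> S. P l = Q l} k"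
  shows "elicitable C n S (k + card C * d)"
proof (rule elicitable_insertion_sort[OF l C(1) subset_refl C(2)])
  fix Q assume Q: "Q \<in> S"
  have "P l \<inter> C \<times> C = P l" if "P \<in> S" for P
    using preferencesD(1)[OF S[OF that]] by blast
  then show "elicitable C n {P \<in> S. P l \<inter> C \<times> C = Q l \<inter> C \<times> C} k"
    using Q by (intro elicitable_mono[OF fin[OF Q]]) auto
qed (use S in auto)

section \<open>The bound\<close>

text \<open>The factor multiplying the sorting cost is the number of preferences that can still be met
  for the first time.\<close>

lemma elicitable_remaining_voters:
  assumes C: "finite C" "card C \<le> 2 ^ d" "card C ^ 2 + 1 \<le> 2 ^ e"
    and Q: "Q \<in> single_crossing_profiles C n" and "l \<le> n"
  shows "elicitable C n {P \<in> single_crossing_profiles C n. \<forall>i\<in>{1..l}. P i = Q i}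
    ((n - l) * (card C + e) + (card C ^ 2 + 1 - card (Q ` {1..l})) * (card C * d))"
  using assms(5,4)
\<comment> \<open>Backward induction from \<open>l = n\<close>, where the whole profile is known.
  \<open>Q\<close> is arbitrary because the next answers may select a different
  continuation.\<close>
proof (induction l arbitrary: Q rule: inc_induct)
  case base
  have "P = Q" if "P \<in> single_crossing_profiles C n" "\<forall>i\<in>{1..n}. P i = Q i" for P
    using that base
    unfolding single_crossing_profiles_def profiles_def by (auto intro: PiE_ext)
  then show ?case by (intro elicitable_subset_singleton) auto
next
  case (step l)
  define S where "S = {P \<in> single_crossing_profiles C n. \<forall>i\<in>{1..l}. P i = Q i}"
  define D where "D = Q ` {1..l}"
  define M where "M = card C ^ 2 + 1"
  define k where "k = (n - Suc l) * (card C + e) + (M - card D) * (card C * d)"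
  have Suc_l: "Suc l \<in> {1..n}" using step.hyps by auto
  have scp: "P \<in> profiles C n" "single_crossing C n P" if "P \<in> single_crossing_profiles C n" for P
    using that unfolding single_crossing_profiles_def by auto
  have S: "P (Suc l) \<in> preferences C" if "P \<in> S" for P
    using that scp(1)[of P] Suc_l unfolding S_def profiles_def by auto
  have image: "P ` {1..Suc l} = insert (P (Suc l)) D" if "P \<in> S" for P
    using that by (auto simp: S_def D_def atLeastAtMostSuc_conv image_iff)
  have known: "elicitable C n {P \<in> S. P (Suc l) = R (Suc l)}
      ((n - Suc l) * (card C + e) + (M - card (insert (R (Suc l)) D)) * (card C * d))"
    if R: "R \<in> S" for R
  proof -
    have "{P \<in> S. P (Suc l) = R (Suc l)}
        \<subseteq> {P \<in> single_crossing_profiles C n. \<forall>i\<in>{1..Suc l}. P i = R i}"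
      using R by (auto simp: S_def le_Suc_eq)
    then show ?thesis
      using step.IH[of R] R image[OF R] unfolding M_def
      by (auto simp: S_def elim!: elicitable_mono)
  qed
  have "elicitable C n S (k + card C + e)"
  proof (rule elicitable_lookup[OF Suc_l C(1) scp[OF step.prems]])
    show D: "D \<subseteq> Q ` {1..n}" using step.hyps by (auto simp: D_def)
    have "card D \<le> card (Q ` {1..n})" using D by (intro card_mono) auto
    also have "\<dots> \<le> M"
      unfolding M_def using single_crossing_card_image scp[OF step.prems] C(1) by blast
    finally show "card D \<le> 2 ^ e" using C(3) by (simp add: M_def)
    \<comment> \<open>A known preference leaves \<open>D\<close>, and hence the sorting budget,
      unchanged.\<close>
    show "elicitable C n {P \<in> S. P (Suc l) = r} k" if r: "r \<in> D" for r
    proof (cases "\<exists>R\<in>S. R (Suc l) = r")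
      case True
      then obtain R where "R \<in> S" "R (Suc l) = r" by blast
      then show ?thesis using known[of R] r by (simp add: k_def insert_absorb)
    next
      case False
      then show ?thesis by (intro elicitable_subset_singleton) auto
    qed
    show "elicitable C n {P \<in> S. P (Suc l) \<notin> D} k"
    proof (cases "{P \<in> S. P (Suc l) \<notin> D} = {}")
      case True
      then show ?thesis by (intro elicitable_subset_singleton) auto
    next
      case False
      \<comment> \<open>The second claim makes the truncated difference \<open>M - card D\<close>
        positive, so that it really drops by one and pays for the sort. It holds since
        \<open>R\<close> is itself single crossing.\<close>
      have D': "card (insert (R (Suc l)) D) = Suc (card D)" "Suc (card D) \<le> M"
        if R: "R \<in> S" "R (Suc l) \<notin> D" for R
      proof -
        show eq: "card (insert (R (Suc l)) D) = Suc (card D)"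
          using R by (simp add: D_def)
        have "card (R ` {1..Suc l}) \<le> card (R ` {1..n})"
          using Suc_l by (intro card_mono image_mono) auto
        also have "R \<in> single_crossing_profiles C n" using R(1) by (simp add: S_def)
        then have "card (R ` {1..n}) \<le> M"
          unfolding M_def by (intro single_crossing_card_image scp C(1))
        finally show "Suc (card D) \<le> M" using eq image[OF R(1)] by simp
      qed
      define k' where "k' = (n - Suc l) * (card C + e) + (M - Suc (card D)) * (card C * d)"
      have "elicitable C n {P \<in> S. P (Suc l) \<notin> D} (k' + card C * d)"
      proof (rule elicitable_sort[OF Suc_l C(1,2)])
        fix R assume "R \<in> {P \<in> S. P (Suc l) \<notin> D}"
        then show "elicitable C n {P \<in> {P \<in> S. P (Suc l) \<notin> D}. P (Suc l) = R (Suc l)} k'"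
          using known[of R] D'(1)[of R] by (auto simp: k'_def elim!: elicitable_mono)
      qed (use S in auto)
      moreover have "k' + card C * d = k"
      proof -
        have "M - card D = Suc (M - Suc (card D))" using False D'(2) Suc_diff_Suc[of "card D" M] by fastforce
        then show ?thesis by (simp add: k_def k'_def)
      qed
      ultimately show ?thesis by simp
    qed
  qed (use S in auto)
  moreover have "n - l = Suc (n - Suc l)" using step.hyps by auto
  then have "k + card C + e
      = (n - l) * (card C + e) + (M - card (Q ` {1..l})) * (card C * d)"
    by (simp add: k_def D_def)
  ultimately show ?case by (simp add: S_def M_def)
qed

text \<open>A search depth linear in \<open>m\<close> is good enough, since verification already
  costs \<open>m\<close> queries per voter.\<close>

lemma square_le_power2: "(m::nat) ^ 2 + 1 \<le> 2 ^ (m + 2)"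
proof -
  \<comment> \<open>Strengthened so that the increment \<open>2 * m + 3\<close> of the left side is
    at most the left side itself.\<close>
  have "m ^ 2 + 2 * m + 3 \<le> 2 ^ (m + 2)"
    by (induction m) (auto simp: power2_eq_square)
  then show ?thesis by simp
qed

theorem corollary1:
  "\<exists>K::real. K > 0 \<and>
     (\<forall>(m::nat) (n::nat) (C::nat set). m \<ge> 2 \<and> n \<ge> 2 \<and> finite C \<and> card C = m \<longrightarrow>
       (\<exists>A. preference_elicitation C n (single_crossing_profiles C n) A \<and>
            real (query_complexity (single_crossing_profiles C n) A)
              \<le> K * (real m * real n + real m ^ 3 * log 2 (real m))))"
\<comment> \<open>The constant 4 serves both terms: \<open>n * (2 * m + 2)\<close> is at most
  \<open>4 * m * n\<close>, and \<open>2 * m ^ 3 * d\<close> is at most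
  \<open>4 * m ^ 3 * log 2 m\<close>.\<close>
proof (intro exI[of _ 4] conjI allI impI)
  fix m n :: nat and C :: "nat set"
  assume "m \<ge> 2 \<and> n \<ge> 2 \<and> finite C \<and> card C = m"
  then have m: "m \<ge> 2" and C: "finite C" "card C = m" by auto
  define d where "d = nat \<lceil>log 2 (real m)\<rceil>"
  have log: "1 \<le> log 2 (real m)" using m by (simp add: le_log_iff)
  have "real m = 2 powr log 2 (real m)" using m by simp
  also have "\<dots> \<le> 2 powr real d"
    unfolding d_def by (intro powr_mono) (auto simp: real_nat_ceiling_ge)
  finally have md: "m \<le> 2 ^ d" by (simp add: powr_realpow)
  \<comment> \<open>Rounding up adds at most 1, which is at most \<open>log 2 m\<close> because
    \<open>m\<close> is at least 2.\<close>
  have d: "real d \<le> 2 * log 2 (real m)" using log unfolding d_def by linarith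
  let ?S = "single_crossing_profiles C n"
  define b where "b = n * (m + (m + 2)) + (m ^ 2 + 1) * (m * d)"
  obtain Q where Q: "Q \<in> ?S" using single_crossing_profiles_nonempty by blast
  \<comment> \<open>At \<open>l = 0\<close> agreement with \<open>Q\<close> is vacuous, so any
    \<open>Q\<close> will do.\<close>
  have "elicitable C n ?S b"
    using elicitable_remaining_voters[OF C(1) _ _ Q, of d "m + 2" 0] md square_le_power2[of m]
    by (simp add: C(2) b_def)
  then obtain A where A: "valid_queries C n A"
    "\<And>P. P \<in> ?S \<Longrightarrow> run A P = P \<and> card (comparisons A P) \<le> b"
    unfolding elicitable_def by blast
  have "query_complexity ?S A \<le> b"
    unfolding query_complexity_def
    using A(2) Q finite_single_crossing_profiles[OF C(1)] by (intro Max.boundedI) auto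
  also have "b \<le> 4 * (m * n) + 2 * m ^ 3 * d"
  proof -
    have "n * (m + (m + 2)) \<le> n * (4 * m)" using m by (intro mult_left_mono) auto
    moreover have "m ^ 2 + 1 \<le> 2 * m ^ 2" using m by simp
    then have "(m ^ 2 + 1) * (m * d) \<le> (2 * m ^ 2) * (m * d)" by (rule mult_right_mono) simp
    ultimately have "b \<le> n * (4 * m) + (2 * m ^ 2) * (m * d)"
      unfolding b_def by (rule add_mono)
    then show ?thesis
      by (simp add: power2_eq_square power3_eq_cube algebra_simps)
  qed
  finally have "real (query_complexity ?S A) \<le> real (4 * (m * n) + 2 * m ^ 3 * d)"
    using of_nat_mono by blast
  also have "\<dots> = 4 * (real m * real n) + 2 * real m ^ 3 * real d" by simp
  also have "\<dots> \<le> 4 * (real m * real n) + 2 * real m ^ 3 * (2 * log 2 (real m))"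
    using d by (intro add_left_mono mult_left_mono) auto
  finally have "real (query_complexity ?S A)
      \<le> 4 * (real m * real n + real m ^ 3 * log 2 (real m))"
    by (simp add: algebra_simps)
  then show "\<exists>A. preference_elicitation C n ?S A \<and> real (query_complexity ?S A)
      \<le> 4 * (real m * real n + real m ^ 3 * log 2 (real m))"
    using A unfolding preference_elicitation_def by blast
qed simp

end
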